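(* There exists a constant $C>0$ such that for any positive integers $m,k$ with $k>1$, $$\Big\|\sum_{n=m+1}^{\infty}\frac{e(n^k x)}{n}\Big\|_*\ \geq\ \frac{C}{k}.$$
   Context: Notation: $e(y):=e^{2\pi i y}$ and $\mathbb{T}=\mathbb{R}/\mathbb{Z}$. For a $1$-periodic function $h$, integrable on a period, and an interval $I\subset\mathbb{T}$, let $h_I=|I|^{-1}\int_I h$ be the average of $h$ on $I$, $\|h\|_I=|I|^{-1}\int_I|h-h_I|$, and $\|h\|_*:=\sup_{I\subset\mathbb{T}}\|h\|_I$ (the BMO norm), the supremum being over all intervals $I\subset\mathbb{T}$. The series $\sum_{n=m+1}^{\infty}e(n^kx)/n$ denotes the function of $x$ to which it converges in $L^2(\mathbb{T})$. *)

theory Defs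
  imports "HOL-Analysis.Analysis"
begin

text \<open>
  Functions on the circle \<open>\<real>/\<int>\<close> are represented by 1-periodic functions on the real line.
\<close>

definition e1 :: "real \<Rightarrow> complex" where
  "e1 y = exp (2 * of_real pi * \<i> * of_real y)"

definition one_periodic :: "(real \<Rightarrow> complex) \<Rightarrow> bool" where
  "one_periodic h \<longleftrightarrow> (\<forall>x. h (x + 1) = h x)"

definition L2_circle :: "(real \<Rightarrow> complex) set" where
  "L2_circle = {h. one_periodic h \<and> h \<in> borel_measurable lebesgue \<and>
     set_integrable lebesgue {0..1} (\<lambda>x. (cmod (h x))\<^sup>2)}"

text \<open>
  The nonnegative integral is used so that a non-integrable difference has distance \<open>\<infinity>\<close>
  rather than the default value 0 of the Bochner integral.
\<close>

definition tendsto_L2 :: "(nat \<Rightarrow> real \<Rightarrow> complex) \<Rightarrow> (real \<Rightarrow> complex) \<Rightarrow> bool" where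
  "tendsto_L2 S f \<longleftrightarrow> f \<in> L2_circle \<and> (\<forall>N. S N \<in> L2_circle) \<and>
     (\<lambda>N. \<integral>\<^sup>+x\<in>{0..1}. ennreal ((cmod (S N x - f x))\<^sup>2) \<partial>lebesgue) \<longlonglongrightarrow> 0"

text \<open>
  Intervals of the circle are arcs, each lifted to a real interval of length at most 1; an arc
  may pass through the point \<open>0 \<in> \<real>/\<int>\<close>. Endpoints are immaterial for the integrals below.
\<close>

definition arcs :: "real set set" where
  "arcs = {{a..b} | a b. a < b \<and> b \<le> a + 1}"

definition avg :: "(real \<Rightarrow> complex) \<Rightarrow> real set \<Rightarrow> complex" where
  "avg h I = (LINT x:I|lebesgue. h x) /\<^sub>R measure lebesgue I"

definition mean_osc :: "(real \<Rightarrow> complex) \<Rightarrow> real set \<Rightarrow> real" where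
  "mean_osc h I = (LINT x:I|lebesgue. cmod (h x - avg h I)) / measure lebesgue I"

text \<open>
  Only meaningful for 1-periodic functions that are integrable on a period; the value \<open>\<infinity>\<close>
  is allowed, for functions of unbounded mean oscillation.
\<close>

definition bmo_norm :: "(real \<Rightarrow> complex) \<Rightarrow> ennreal" where
  "bmo_norm h = (SUP I\<in>arcs. ennreal (mean_osc h I))"

end

theory Submission
  imports Defs
begin

text \<open>
  Near the origin the function \<open>f x = (\<Sum>n>m. e1 (n^k * x) / n)\<close> has a logarithmic
  singularity: at scale \<open>d\<close> the terms with \<open>n^k * d\<close> small add up coherently, and the others
  cancel. Enlarging the range of coherent \<open>n\<close> by a constant factor changes the average of \<open>f\<close> by
  a constant, but costs a factor exponential in \<open>k\<close> in the length of the interval, hence only a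
  number of halvings proportional to \<open>k\<close>. Each halving changes the average by at most twice the
  BMO norm, which therefore is at least of order \<open>1 / k\<close>.

  In detail, the real part of the average of \<open>e1 (t * x)\<close> over \<open>{0..d}\<close> is \<open>sin y / y\<close> with
  \<open>y = 2 * pi * t * d\<close>. Write \<open>d\<^sub>M = 1 / (2 * M^k)\<close>, so that \<open>y = pi * (n / M)^k\<close> for the
  \<open>n\<close>-th term. For \<open>M = m\<close> the whole series is a tail, and the real part is at most \<open>1/3\<close>
  (\<open>sinc_tail_le\<close>). For \<open>M = 16 * m\<close> the terms with \<open>n \<le> 8 * m\<close> contribute at least 1, those
  with \<open>8 * m < n \<le> 16 * m\<close> are nonnegative, and the tail is at least \<open>-1/3\<close>
  (\<open>sinc_main_ge\<close>). So the averages over \<open>{0..d}\<close> and \<open>{0..d / 2^(4*k)}\<close>, where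
  \<open>d = 1 / (2 * m^k)\<close>, differ by at least \<open>1/3\<close> (\<open>avg_jump\<close>), while \<open>avg_dyadic_diff_le\<close>
  bounds the difference by \<open>8 * k\<close> times the BMO norm. This gives the constant \<open>1/24\<close>.
\<close>

section \<open>Averages and mean oscillation\<close>

text \<open>
  The difference is the average over \<open>I\<close> of \<open>h - avg h J\<close>. Its modulus is integrated over the
  larger set \<open>J\<close>, which costs the ratio of the measures.
\<close>

lemma avg_subset_diff_le:
  assumes h: "set_integrable lebesgue J h"
    and I: "I \<in> lmeasurable" "I \<subseteq> J" "measure lebesgue I > 0"
    and J: "J \<in> lmeasurable"
  shows "cmod (avg h I - avg h J) \<le> measure lebesgue J / measure lebesgue I * mean_osc h J"
proof -
  define c where "c = avg h J"
  have J_pos: "measure lebesgue J > 0"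
    using I J measure_mono_fmeasurable[of I J lebesgue] by (auto simp: fmeasurableD)
  have const_I: "set_integrable lebesgue I (\<lambda>x. c)" and const_J: "set_integrable lebesgue J (\<lambda>x. c)"
    using I J by (auto intro: absolutely_integrable_on_const)
  have h_I: "set_integrable lebesgue I h"
    using set_integrable_subset[OF h] I by (auto simp: fmeasurableD)
  have diff_J: "set_integrable lebesgue J (\<lambda>x. cmod (h x - c))"
    using set_integral_diff(1)[OF h const_J] by (rule set_integrable_norm)
  have diff_I: "set_integrable lebesgue I (\<lambda>x. h x - c)"
    using h_I const_I by auto
  have "(LINT x:I|lebesgue. c) = measure lebesgue I *\<^sub>R c"
    using I unfolding set_lebesgue_integral_def by (intro has_bochner_integral_integral_eq
      has_bochner_integral_scaleR_left has_bochner_integral_real_indicator)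
      (auto dest: fmeasurableD fmeasurableD2 simp: less_top[symmetric] simp del: emeasure_completion)
  then have "(LINT x:I|lebesgue. h x - c) = (LINT x:I|lebesgue. h x) - measure lebesgue I *\<^sub>R c"
    using set_integral_diff(2)[OF h_I const_I] by simp
  then have "avg h I - c = (LINT x:I|lebesgue. h x - c) /\<^sub>R measure lebesgue I"
    using I by (simp add: avg_def scaleR_diff_right)
  then have "cmod (avg h I - c) = cmod (LINT x:I|lebesgue. h x - c) / measure lebesgue I"
    using I by (simp add: divide_inverse)
  also have "\<dots> \<le> (LINT x:I|lebesgue. cmod (h x - c)) / measure lebesgue I"
    using set_integral_norm_bound[OF diff_I] I by (simp add: divide_right_mono)
  also have "\<dots> \<le> (LINT x:J|lebesgue. cmod (h x - c)) / measure lebesgue I"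
  proof -
    have "(LINT x:I|lebesgue. cmod (h x - c)) \<le> (LINT x:J|lebesgue. cmod (h x - c))"
      using diff_J set_integrable_norm[OF diff_I] \<open>I \<subseteq> J\<close>
      unfolding set_lebesgue_integral_def set_integrable_def
      by (intro integral_mono) (auto simp: indicator_def)
    then show ?thesis
      using I by (intro divide_right_mono) auto
  qed
  also have "\<dots> = measure lebesgue J / measure lebesgue I * mean_osc h J"
    using J_pos by (simp add: mean_osc_def c_def)
  finally show ?thesis
    by (simp add: c_def)
qed

text \<open>
  A function of bounded mean oscillation has averages that vary at most logarithmically in the
  length of the interval: one step of the telescoping sum per halving.
\<close>

lemma avg_dyadic_diff_le:
  assumes h: "set_integrable lebesgue {0..1} h" and d: "0 < d" "d \<le> 1"
    and B: "\<And>I. I \<in> arcs \<Longrightarrow> mean_osc h I \<le> B"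
  shows "cmod (avg h {0..d / 2 ^ j} - avg h {0..d}) \<le> 2 * real j * B"
proof (induction j)
  case 0
  show ?case by simp
next
  case (Suc j)
  let ?I = "{0..d / 2 ^ Suc j}" and ?J = "{0..d / 2 ^ j}"
  have le: "d / 2 ^ j \<le> 1"
    using d by (simp add: field_simps) (meson order_trans two_realpow_ge_one)
  have "?I \<subseteq> ?J"
    using d by (auto simp: field_simps)
  moreover have "set_integrable lebesgue ?J h"
    using le by (intro set_integrable_subset[OF h]) auto
  ultimately have "cmod (avg h ?I - avg h ?J)
      \<le> measure lebesgue ?J / measure lebesgue ?I * mean_osc h ?J"
    using d by (intro avg_subset_diff_le) auto
  also have "\<dots> = 2 * mean_osc h ?J"
    using d by simp
  also have "\<dots> \<le> 2 * B"
  proof -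
    have "?J \<in> arcs"
      unfolding arcs_def mem_Collect_eq using d le
      by (intro exI[of _ 0] exI[of _ "d / 2 ^ j"]) auto
    then show ?thesis using B by simp
  qed
  finally have "cmod (avg h ?I - avg h ?J) \<le> 2 * B" .
  then show ?case
    using Suc.IH norm_triangle_ineq[of "avg h ?I - avg h ?J" "avg h ?J - avg h {0..d}"]
    by (simp add: algebra_simps)
qed

section \<open>Averages of square-integrable functions\<close>

lemma L2_circle_integrable:
  assumes "h \<in> L2_circle"
  shows "set_integrable lebesgue {0..1} h"
proof -
  have h: "h \<in> borel_measurable lebesgue" "set_integrable lebesgue {0..1} (\<lambda>x. (cmod (h x))\<^sup>2)"
    using assms by (auto simp: L2_circle_def)
  have "set_integrable lebesgue {0..1::real} (\<lambda>x. 1::real)"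
    by (intro absolutely_integrable_on_const) auto
  from set_integral_add(1)[OF this h(2)]
  have "set_integrable lebesgue {0..1} (\<lambda>x. 1 + (cmod (h x))\<^sup>2)" .
  moreover have "cmod (h x) \<le> 1 + (cmod (h x))\<^sup>2" for x
    using sum_squares_bound[of "cmod (h x)" 1] by (simp add: power2_eq_square) (smt (verit) norm_ge_zero)
  then have "norm (indicator {0..1} x *\<^sub>R h x) \<le> norm (indicator {0..1} x *\<^sub>R (1 + (cmod (h x))\<^sup>2))" for x :: real
    by (auto simp: indicator_def)
  moreover have "(\<lambda>x. indicator {0..1} x *\<^sub>R h x) \<in> borel_measurable lebesgue"
    using h(1) by (intro borel_measurable_scaleR borel_measurable_indicator) auto
  ultimately show ?thesis
    unfolding set_integrable_def by (blast intro: Bochner_Integration.integrable_bound AE_I2)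
qed

text \<open>Cauchy--Schwarz against the indicator of \<open>I\<close>, whose measure is at most 1.\<close>

lemma integral_square_le:
  assumes g: "set_integrable lebesgue {0..1} g" and I: "I \<in> sets lebesgue" "I \<subseteq> {0..1::real}"
  shows "ennreal ((cmod (LINT x:I|lebesgue. g x))\<^sup>2)
    \<le> (\<integral>\<^sup>+x\<in>{0..1}. ennreal ((cmod (g x))\<^sup>2) \<partial>lebesgue)"
proof -
  define u where "u x = indicator {0..1} x *\<^sub>R g x" for x
  have g_I: "set_integrable lebesgue I g"
    by (rule set_integrable_subset[OF g I])
  have [measurable]: "u \<in> borel_measurable lebesgue"
    using g unfolding u_def[abs_def] set_integrable_def by (rule borel_measurable_integrable)
  note [measurable] = I(1)
  have "ennreal (cmod (LINT x:I|lebesgue. g x))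
      \<le> (\<integral>\<^sup>+x. ennreal (cmod (indicator I x *\<^sub>R g x)) \<partial>lebesgue)"
    using g_I unfolding set_lebesgue_integral_def set_integrable_def
    by (rule integral_norm_bound_ennreal)
  also have "\<dots> = (\<integral>\<^sup>+x. ennreal (cmod (u x)) * indicator I x \<partial>lebesgue)"
    using I(2) by (intro nn_integral_cong) (auto simp: u_def indicator_def)
  finally have "(ennreal (cmod (LINT x:I|lebesgue. g x)))\<^sup>2
      \<le> (\<integral>\<^sup>+x. ennreal (cmod (u x)) * indicator I x \<partial>lebesgue)\<^sup>2"
    by (rule power_mono) simp
  also have "\<dots> \<le> (\<integral>\<^sup>+x. (ennreal (cmod (u x)))\<^sup>2 \<partial>lebesgue) *
      (\<integral>\<^sup>+x. (indicator I x)\<^sup>2 \<partial>lebesgue)"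
    by (rule Cauchy_Schwarz_nn_integral) measurable
  also have "(\<integral>\<^sup>+x. (indicator I x)\<^sup>2 \<partial>lebesgue) = emeasure lebesgue I"
  proof -
    have "(indicator I x :: ennreal)\<^sup>2 = indicator I x" for x
      by (simp add: indicator_def)
    then show ?thesis
      using I(1) by (simp only: nn_integral_indicator)
  qed
  also have "emeasure lebesgue I \<le> 1"
    using emeasure_mono[of I "{0..1}" lebesgue] I by simp
  also have "(\<integral>\<^sup>+x. (ennreal (cmod (u x)))\<^sup>2 \<partial>lebesgue)
      = (\<integral>\<^sup>+x\<in>{0..1}. ennreal ((cmod (g x))\<^sup>2) \<partial>lebesgue)"
    by (intro nn_integral_cong) (auto simp: u_def indicator_def ennreal_power)
  finally show ?thesis
    by (simp add: ennreal_power mult_left_mono)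
qed

text \<open>
  This carries estimates for the trigonometric partial sums over to the \<open>L\<^sup>2\<close> limit
  without any information about pointwise convergence.
\<close>

lemma tendsto_L2_avg:
  assumes S: "tendsto_L2 S f" and I: "I \<in> sets lebesgue" "I \<subseteq> {0..1}"
  shows "(\<lambda>N. avg (S N) I) \<longlonglongrightarrow> avg f I"
proof -
  have int: "set_integrable lebesgue {0..1} f" "\<And>N. set_integrable lebesgue {0..1} (S N)"
    using S by (auto simp: tendsto_L2_def intro: L2_circle_integrable)
  have int_I: "set_integrable lebesgue I f" "\<And>N. set_integrable lebesgue I (S N)"
    using int I set_integrable_subset by blast+
  have lim: "(\<lambda>N. \<integral>\<^sup>+x\<in>{0..1}. ennreal ((cmod (S N x - f x))\<^sup>2) \<partial>lebesgue) \<longlonglongrightarrow> 0"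
    using S by (simp add: tendsto_L2_def)
  have "(\<lambda>N. ennreal ((cmod (LINT x:I|lebesgue. S N x - f x))\<^sup>2)) \<longlonglongrightarrow> 0"
    by (rule tendsto_sandwich[OF _ _ tendsto_const lim])
       (auto intro!: always_eventually integral_square_le I int)
  then have "(\<lambda>N. (cmod (LINT x:I|lebesgue. S N x - f x))\<^sup>2) \<longlonglongrightarrow> 0"
    using tendsto_ennreal_iff[of "\<lambda>N. (cmod (LINT x:I|lebesgue. S N x - f x))\<^sup>2" sequentially 0] by simp
  then have "(\<lambda>N. LINT x:I|lebesgue. S N x - f x) \<longlonglongrightarrow> 0"
    using tendsto_real_sqrt tendsto_norm_zero_cancel by fastforce
  then have "(\<lambda>N. (LINT x:I|lebesgue. S N x) - (LINT x:I|lebesgue. f x)) \<longlonglongrightarrow> 0"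
    using int_I by simp
  then have "(\<lambda>N. LINT x:I|lebesgue. S N x) \<longlonglongrightarrow> (LINT x:I|lebesgue. f x)"
    by (rule LIM_zero_cancel)
  then show ?thesis
    unfolding avg_def by (intro tendsto_intros)
qed

section \<open>Averages of exponential sums\<close>

lemma e1_has_integral:
  assumes "t \<noteq> 0" "0 \<le> d"
  shows "((\<lambda>x. e1 (t * x)) has_integral (e1 (t * d) - 1) / (2 * pi * t * \<i>)) {0..d}"
proof -
  let ?c = "2 * pi * t * \<i>"
  have "((\<lambda>z. exp (?c * z) / ?c) has_field_derivative exp (?c * of_real x)) (at (of_real x))" for x
    using assms by (auto intro!: derivative_eq_intros)
  note has_vector_derivative_real_field[OF this]
  moreover have "e1 (t * x) = exp (?c * of_real x)" for x
    by (simp add: e1_def mult_ac)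
  ultimately have "((\<lambda>x. e1 (t * x) / ?c) has_vector_derivative e1 (t * x)) (at x within {0..d})" for x
    by simp
  from fundamental_theorem_of_calculus[OF assms(2) this]
  show ?thesis
    by (simp add: e1_def diff_divide_distrib)
qed

text \<open>
  Intervals starting at 0 together with the real part play the role of symmetric intervals: only
  the even part \<open>cos (2 * pi * t * x)\<close> of each exponential contributes.
\<close>

lemma Re_avg_exponential_sum:
  assumes d: "0 < d" and A: "finite A" "\<And>n. n \<in> A \<Longrightarrow> t n > 0"
  shows "Re (avg (\<lambda>x. \<Sum>n\<in>A. e1 (t n * x) / of_nat n) {0..d})
    = (\<Sum>n\<in>A. sin (2 * pi * t n * d) / (2 * pi * t n * d) / real n)"
proof -
  define S where "S x = (\<Sum>n\<in>A. e1 (t n * x) / of_nat n)" for x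
  define v where "v = (\<Sum>n\<in>A. (e1 (t n * d) - 1) / (2 * pi * t n * \<i>) / of_nat n)"
  have "(S has_integral v) {0..d}"
    unfolding S_def[abs_def] v_def using A d
    by (intro has_integral_sum has_integral_divide e1_has_integral) force+
  moreover have "continuous_on {0..d} S"
    unfolding S_def[abs_def] e1_def divide_inverse by (intro continuous_intros)
  ultimately have "(LINT x:{0..d}|lebesgue. S x) = v"
    using set_lebesgue_integral_eq_integral(2)[OF absolutely_integrable_continuous_real, of 0 d S]
    by (simp add: integral_unique)
  then have "Re (avg S {0..d}) = Re v / d"
    using d by (simp add: avg_def divide_inverse mult.commute)
  also have "\<dots> = (\<Sum>n\<in>A. Re ((e1 (t n * d) - 1) / (2 * pi * t n * \<i>)) / real n / d)"
    by (simp only: v_def Re_sum sum_divide_distrib Re_divide_of_nat)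
  also have "\<dots> = (\<Sum>n\<in>A. sin (2 * pi * t n * d) / (2 * pi * t n * d) / real n)"
  proof (rule sum.cong[OF refl])
    fix n assume "n \<in> A"
    have "(e1 (t n * d) - 1) / (2 * pi * t n * \<i>) = (e1 (t n * d) - 1) / \<i> / of_real (2 * pi * t n)"
      by (simp only: divide_divide_eq_left mult.commute)
    then have "Re ((e1 (t n * d) - 1) / (2 * pi * t n * \<i>)) = Im (e1 (t n * d)) / (2 * pi * t n)"
      by (simp only: Re_divide_of_real) simp
    also have "Im (e1 (t n * d)) = sin (2 * pi * t n * d)"
      by (simp add: e1_def Im_exp mult.assoc)
    finally show "Re ((e1 (t n * d) - 1) / (2 * pi * t n * \<i>)) / real n / d
        = sin (2 * pi * t n * d) / (2 * pi * t n * d) / real n"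
      by (simp add: mult_ac)
  qed
  finally show ?thesis
    by (simp only: S_def[abs_def])
qed

section \<open>Bounds for the kernel\<close>

text \<open>
  By the mean value theorem the slope \<open>sin y / y\<close> is a value of the cosine on \<open>{0..pi / 4}\<close>, so
  it is at least \<open>sqrt 2 / 2\<close>. The rational bound \<open>2/3\<close> keeps later constants simple.
\<close>

lemma sin_ge_two_thirds:
  fixes y :: real
  assumes "0 \<le> y" "y \<le> pi / 4"
  shows "2 / 3 * y \<le> sin y"
proof (cases "y = 0")
  case False
  then obtain z where z: "0 < z" "z < y" "sin y - sin 0 = (y - 0) * cos z"
    using assms MVT2[of 0 y sin cos] by (auto intro: DERIV_sin)
  have "cos (pi / 4) \<le> cos z"
    using z assms by (intro cos_monotone_0_pi_le) auto
  moreover have "4 / 3 \<le> sqrt 2"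
    by (rule real_le_rsqrt) (simp add: power2_eq_square)
  ultimately have "2 / 3 \<le> cos z"
    by (simp add: cos_45)
  then show ?thesis
    using z assms by (simp add: mult.commute mult_left_mono)
qed auto

lemma pi_ge_three: "3 \<le> pi"
  using sin_x_le_x[of "pi / 6"] by (simp add: sin_30)

text \<open>Each dyadic block \<open>{M+1..2*M}\<close> has \<open>M\<close> terms, all at least \<open>1 / (2 * M)\<close>.\<close>

lemma sum_reciprocal_dyadic_ge:
  assumes "m > 0"
  shows "real j / 2 \<le> (\<Sum>n=m+1..2^j * m. 1 / real n)"
proof (induction j)
  case 0
  show ?case by simp
next
  case (Suc j)
  let ?M = "2 ^ j * m"
  have "1 / 2 = (\<Sum>n=?M+1..2*?M. 1 / real (2 * ?M))"
    using assms by simp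
  also have "\<dots> \<le> (\<Sum>n=?M+1..2*?M. 1 / real n)"
  proof (intro sum_mono divide_left_mono)
    fix n assume n: "n \<in> {?M+1..2*?M}"
    then show "real n \<le> real (2 * ?M)"
      by (simp only: atLeastAtMost_iff of_nat_le_iff)
    show "0 < real (2 * ?M) * real n"
      using n assms by auto
  qed simp
  finally have "1 / 2 \<le> (\<Sum>n=?M+1..2*?M. 1 / real n)" .
  moreover have "(\<Sum>n=m+1..2 ^ Suc j * m. 1 / real n)
      = (\<Sum>n=m+1..?M. 1 / real n) + (\<Sum>n=?M+1..2*?M. 1 / real n)"
    using sum.ub_add_nat[of "m+1" "?M" "\<lambda>n. 1 / real n" ?M]
    by (simp add: mult_2 distrib_right)
  ultimately show ?case
    using Suc.IH by simp
qed

lemma sum_reciprocal_square_le: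
  assumes "M > 0"
  shows "(\<Sum>n=M+1..N. 1 / (real n)\<^sup>2) \<le> 1 / real M"
proof (cases "M \<le> N")
  case True
  \<comment> \<open>The sharper bound is the one that telescopes, by \<open>1 / n\<^sup>2 \<le> 1 / (n - 1) - 1 / n\<close>.\<close>
  have "(\<Sum>n=M+1..N. 1 / (real n)\<^sup>2) \<le> 1 / real M - 1 / real N"
    using True
  proof (induction N rule: dec_induct)
    case (step N)
    have "1 / (real (Suc N))\<^sup>2 \<le> 1 / real N - 1 / real (Suc N)"
      using step.hyps assms by (simp add: divide_simps power2_eq_square)
    then show ?case using step by simp
  qed simp
  then show ?thesis by (smt (verit) of_nat_0_le_iff zero_le_divide_1_iff)
qed auto

text \<open>
  Beyond \<open>M\<close> the power \<open>(n / M)^k\<close> dominates \<open>n / M\<close>, so that \<open>\<bar>sin (y n)\<bar> / y n \<le> M / (3 * n)\<close>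
  and the tail is at most \<open>M / 3\<close> times \<open>\<Sum>n>M. 1 / n\<^sup>2\<close>. The bound is uniform in \<open>k\<close> and \<open>M\<close>.
\<close>

lemma sinc_tail_le:
  assumes "M > 0" "k > 0"
  defines "y \<equiv> \<lambda>n. pi * (real n / real M) ^ k"
  shows "\<bar>\<Sum>n=M+1..N. sin (y n) / y n / real n\<bar> \<le> 1 / 3"
proof -
  have term_le: "\<bar>sin (y n) / y n / real n\<bar> \<le> real M / 3 * (1 / (real n)\<^sup>2)" if n: "n \<in> {M+1..N}" for n
  proof -
    have "real n / real M \<le> (real n / real M) ^ k"
      using n assms by (intro self_le_power) auto
    then have "3 * (real n / real M) \<le> y n"
      unfolding y_def using pi_ge_three by (intro mult_mono) auto
    moreover have "real n / real M > 0"
      using n assms by simp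
    ultimately have "1 / y n \<le> 1 / (3 * (real n / real M))" "y n > 0"
      by (auto intro!: divide_left_mono mult_pos_pos simp del: divide_divide_eq_right times_divide_eq_right)
    then have "\<bar>sin (y n)\<bar> / y n \<le> 1 / (3 * (real n / real M))"
      by (smt (verit) abs_sin_le_one divide_right_mono)
    then have "\<bar>sin (y n)\<bar> / y n / real n \<le> 1 / (3 * (real n / real M)) / real n"
      by (rule divide_right_mono) simp
    then show ?thesis
      using \<open>y n > 0\<close> by (simp add: power2_eq_square)
  qed
  have "\<bar>\<Sum>n=M+1..N. sin (y n) / y n / real n\<bar> \<le> (\<Sum>n=M+1..N. real M / 3 * (1 / (real n)\<^sup>2))"
    by (rule order_trans[OF sum_abs sum_mono]) (rule term_le)
  also have "\<dots> = real M / 3 * (\<Sum>n=M+1..N. 1 / (real n)\<^sup>2)"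
    by (rule sum_distrib_left[symmetric])
  also have "\<dots> \<le> real M / 3 * (1 / real M)"
    using assms by (intro mult_left_mono sum_reciprocal_square_le) auto
  also have "\<dots> = 1 / 3"
    using assms by simp
  finally show ?thesis .
qed

text \<open>
  The factor 16 is chosen so that the range \<open>{m+1..8*m}\<close>, on which the arguments stay
  below \<open>pi / 4\<close>, comprises three dyadic blocks; their contribution \<open>2/3 * 3/2 = 1\<close> outweighs
  the possible loss \<open>1/3\<close> from the tail. The hypothesis \<open>k > 1\<close> enters through
  \<open>(n / (16 * m))^k \<le> (1/2)\<^sup>2\<close>.
\<close>

lemma sinc_main_ge:
  assumes m: "m > 0" and k: "k > 1" and N: "16 * m \<le> N"
  defines "y \<equiv> \<lambda>n. pi * (real n / real (16 * m)) ^ k"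
  shows "2 / 3 \<le> (\<Sum>n=m+1..N. sin (y n) / y n / real n)"
proof -
  let ?s = "\<lambda>n. sin (y n) / y n / real n"
  have near: "2 / 3 * (1 / real n) \<le> ?s n" if n: "n \<in> {m+1..8*m}" for n
  proof -
    have "(real n / real (16 * m)) ^ k \<le> (1 / 2) ^ k"
      using n m by (intro power_mono) (auto simp: field_simps)
    also have "\<dots> \<le> (1 / 2) ^ 2"
      using k by (intro power_decreasing) auto
    finally have "y n \<le> pi / 4"
      by (simp add: y_def power2_eq_square)
    moreover have "y n > 0"
      using n m by (simp add: y_def)
    ultimately have "2 / 3 \<le> sin (y n) / y n"
      using sin_ge_two_thirds[of "y n"] by (simp add: field_simps)
    then show ?thesis
      using divide_right_mono[of "2 / 3" _ "real n"] by fastforce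
  qed
  have middle: "0 \<le> ?s n" if n: "n \<in> {8*m+1..16*m}" for n
  proof -
    have "(real n / real (16 * m)) ^ k \<le> 1"
      using n m by (intro power_le_one) auto
    then have "0 \<le> y n" "y n \<le> pi"
      by (auto simp: y_def)
    then show ?thesis
      by (simp add: sin_ge_zero)
  qed
  have "1 = 2 / 3 * (real 3 / 2)"
    by simp
  also have "\<dots> \<le> 2 / 3 * (\<Sum>n=m+1..8*m. 1 / real n)"
    using sum_reciprocal_dyadic_ge[OF m, of 3] by simp
  also have "\<dots> = (\<Sum>n=m+1..8*m. 2 / 3 * (1 / real n))"
    by (rule sum_distrib_left)
  also have "\<dots> \<le> (\<Sum>n=m+1..8*m. ?s n)"
    by (rule sum_mono) (rule near)
  finally have "1 \<le> (\<Sum>n=m+1..8*m. ?s n)" .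
  moreover have "0 \<le> (\<Sum>n=8*m+1..16*m. ?s n)"
    by (rule sum_nonneg) (rule middle)
  moreover have "- (1 / 3) \<le> (\<Sum>n=16*m+1..N. ?s n)"
    using sinc_tail_le[of "16 * m" k N] m k by (simp add: y_def abs_le_iff)
  moreover have "(\<Sum>n=m+1..N. ?s n)
      = (\<Sum>n=m+1..8*m. ?s n) + (\<Sum>n=8*m+1..16*m. ?s n) + (\<Sum>n=16*m+1..N. ?s n)"
    using sum.ub_add_nat[of "m+1" "8*m" ?s "8*m"] sum.ub_add_nat[of "m+1" "16*m" ?s "N-16*m"] N m
    by simp
  ultimately show ?thesis
    by linarith
qed

section \<open>The lower bound\<close>

text \<open>
  The length \<open>d\<close> is the scale at which every term of the series already oscillates. Dividing it by
  \<open>2 ^ (4 * k) = 16 ^ k\<close> amounts to replacing \<open>m\<close> by \<open>16 * m\<close> in \<open>d\<close>.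
\<close>

lemma avg_jump:
  assumes f: "tendsto_L2 (\<lambda>N x. \<Sum>n=m+1..N. e1 (real n ^ k * x) / of_nat n) f"
    and m: "m > 0" and k: "k > 1"
  defines "d \<equiv> 1 / (2 * real m ^ k)"
  shows "1 / 3 \<le> cmod (avg f {0..d / 2 ^ (4 * k)} - avg f {0..d})"
proof -
  let ?S = "\<lambda>N x. \<Sum>n=m+1..N. e1 (real n ^ k * x) / of_nat n"
  let ?d' = "d / 2 ^ (4 * k)"
  have d_pos: "0 < d"
    using m by (simp add: d_def)
  have "1 \<le> real m ^ k"
    using m by (intro one_le_power) simp
  then have d_le: "d \<le> 1"
    by (simp add: d_def divide_le_eq)
  have d'_le: "?d' \<le> d"
    using d_pos by (simp add: divide_le_eq mult_le_cancel_left1)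
  have lim: "(\<lambda>N. Re (avg (?S N) {0..r})) \<longlonglongrightarrow> Re (avg f {0..r})" if "r \<le> d" for r
    using that d_le by (intro tendsto_Re tendsto_L2_avg[OF f]) auto
  have arg: "2 * pi * real n ^ k * d = pi * (real n / real m) ^ k"
    "2 * pi * real n ^ k * ?d' = pi * (real n / real (16 * m)) ^ k" for n
    using m by (simp_all add: d_def power_divide power_mult_distrib power_mult)
  have "Re (avg (?S N) {0..d}) \<le> 1 / 3" for N
    using sinc_tail_le[of m k N] m k d_pos
    by (subst Re_avg_exponential_sum) (auto simp: arg abs_le_iff simp del: of_nat_mult)
  then have "Re (avg f {0..d}) \<le> 1 / 3"
    using LIMSEQ_le_const2[OF lim] by blast
  moreover have "2 / 3 \<le> Re (avg (?S N) {0..?d'})" if "N \<ge> 16 * m" for N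
    using sinc_main_ge[OF m k that] m d_pos
    by (subst Re_avg_exponential_sum) (auto simp only: arg, auto)
  then have "2 / 3 \<le> Re (avg f {0..?d'})"
    using LIMSEQ_le_const[OF lim[OF d'_le]] by blast
  ultimately have "1 / 3 \<le> Re (avg f {0..?d'} - avg f {0..d})"
    by simp
  also have "\<dots> \<le> cmod (avg f {0..?d'} - avg f {0..d})"
    by (rule complex_Re_le_cmod)
  finally show ?thesis .
qed

theorem proposition1:
  "\<exists>C::real. C > 0 \<and>
    (\<forall>m k :: nat. m > 0 \<longrightarrow> k > 1 \<longrightarrow>
      (\<forall>f. tendsto_L2 (\<lambda>N x. \<Sum>n=m+1..N. e1 (real n ^ k * x) / of_nat n) f \<longrightarrow>
        ennreal (C / real k) \<le> bmo_norm f))"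
proof (rule exI[of _ "1 / 24"], intro conjI allI impI)
  fix m k :: nat and f
  assume m: "m > 0" and k: "k > 1"
    and f: "tendsto_L2 (\<lambda>N x. \<Sum>n=m+1..N. e1 (real n ^ k * x) / of_nat n) f"
  show "ennreal (1 / 24 / real k) \<le> bmo_norm f"
  proof (cases "bmo_norm f = \<infinity>")
    case False
    then obtain B where B: "B \<ge> 0" "bmo_norm f = ennreal B"
      by (cases "bmo_norm f") auto
    have osc: "mean_osc f I \<le> B" if "I \<in> arcs" for I
    proof -
      have "ennreal (mean_osc f I) \<le> ennreal B"
        using SUP_upper[OF that, of "\<lambda>I. ennreal (mean_osc f I)"] B by (simp add: bmo_norm_def)
      then show ?thesis
        using B(1) by simp
    qed
    have int: "set_integrable lebesgue {0..1} f"
      using f by (auto simp: tendsto_L2_def intro: L2_circle_integrable)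
    have "1 \<le> real m ^ k"
      using m by (intro one_le_power) simp
    then have "1 \<le> 2 * real m ^ k"
      by linarith
    then have "0 < 1 / (2 * real m ^ k)" "1 / (2 * real m ^ k) \<le> 1"
      using m by (simp_all add: divide_le_eq)
    from avg_dyadic_diff_le[OF int this osc, of "4 * k"] avg_jump[OF f m k]
    have "1 / 3 \<le> 2 * real (4 * k) * B"
      by linarith
    then have "1 / 24 / real k \<le> B"
      using k by (simp add: field_simps)
    then show ?thesis
      by (simp add: B ennreal_leI)
  qed simp
qed simp

end
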